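(* Let $\mathbb{D} \in \{\mathbb{R}, \mathbb{C}, \mathbb{H}\}$, let $n \geq 1$, and let $A, B \in \mathscr{P}_n(\mathbb{D})$. Then the Wasserstein mean $A \diamond B$ is linearizable (i.e. there exist $a, b \in \mathbb{R}$ such that $A \diamond B = aA + bB$) if and only if $AB = BA$ and $|\mathrm{Spec}(A^{-1} \sharp B)| \leq 2$.
   Context: For $\mathbb{D} \in \{\mathbb{R}, \mathbb{C}, \mathbb{H}\}$ (reals, complexes, quaternions), $\mathrm{Mat}_n(\mathbb{D})$ is the set of $n \times n$ matrices over $\mathbb{D}$, $X^* = \overline{X}^{t}$ is the conjugate transpose, and $\mathscr{P}_n(\mathbb{D})$ is the set of $X \in \mathrm{Mat}_n(\mathbb{D})$ with $X = X^*$ and $X > 0$ (positive definite). Every $X \in \mathscr{P}_n(\mathbb{D})$ can be written $X = U \,\mathrm{diag}(d_1, \ldots, d_n)\, U^*$ with $U U^* = \mathrm{Id}_n$ and real $d_i > 0$; the $d_i$ are the eigenvalues of $X$ (right eigenvalues when $\mathbb{D} = \mathbb{H}$), and $\mathrm{Spec}(X)$ is the set of eigenvalues, so $|\mathrm{Spec}(X)|$ is the number of distinct eigenvalues. Real powers of $X$ are defined by $X^t = U\,\mathrm{diag}(d_1^t, \ldots, d_n^t)\,U^*$. The geometric mean of $A, B \in \mathscr{P}_n(\mathbb{D})$ is $A \sharp B = A^{1/2}\left(A^{-1/2} B A^{-1/2}\right)^{1/2} A^{1/2}$; thus $A^{-1} \sharp B$ is the geometric mean of $A^{-1}$ and $B$.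 The Wasserstein mean of $A, B \in \mathscr{P}_n(\mathbb{D})$ is $$A \diamond B = \tfrac{1}{4}\left(\mathrm{Id}_n + A^{-1} \sharp B\right) A \left(\mathrm{Id}_n + A^{-1} \sharp B\right).$$ *)

theory Defs
  imports "HOL-Analysis.Analysis"
begin

section \<open>The division algebras of real, complex and quaternionic numbers\<close>

datatype quat = Quat (q_re: real) (q_i: real) (q_j: real) (q_k: real)

instantiation quat :: real_div_algebra
begin

definition "0 = Quat 0 0 0 0"
definition "1 = Quat 1 0 0 0"
definition "x + y = Quat (q_re x + q_re y) (q_i x + q_i y) (q_j x + q_j y) (q_k x + q_k y)"
definition "x - y = Quat (q_re x - q_re y) (q_i x - q_i y) (q_j x - q_j y) (q_k x - q_k y)"
definition "- x = Quat (- q_re x) (- q_i x) (- q_j x) (- q_k x)"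
definition "r *\<^sub>R x = Quat (r * q_re x) (r * q_i x) (r * q_j x) (r * q_k x)"

(* Hamilton product: i * i = j * j = k * k = i * j * k = -1 *)
definition "x * y = Quat
  (q_re x * q_re y - q_i x * q_i y - q_j x * q_j y - q_k x * q_k y)
  (q_re x * q_i y + q_i x * q_re y + q_j x * q_k y - q_k x * q_j y)
  (q_re x * q_j y - q_i x * q_k y + q_j x * q_re y + q_k x * q_i y)
  (q_re x * q_k y + q_i x * q_j y - q_j x * q_i y + q_k x * q_re y)"

definition "inverse x =
  (1 / ((q_re x)\<^sup>2 + (q_i x)\<^sup>2 + (q_j x)\<^sup>2 + (q_k x)\<^sup>2))
    *\<^sub>R Quat (q_re x) (- q_i x) (- q_j x) (- q_k x)"
definition "x div (y::quat) = x * inverse y"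

lemmas quat_ops = zero_quat_def one_quat_def plus_quat_def minus_quat_def uminus_quat_def
  scaleR_quat_def times_quat_def

lemma quat_normsq_eq_0:
  "(q_re x)\<^sup>2 + (q_i x)\<^sup>2 + (q_j x)\<^sup>2 + (q_k x)\<^sup>2 = 0 \<longleftrightarrow> x = 0"
  by (cases x) (simp add: zero_quat_def add_nonneg_eq_0_iff)

instance
proof
  fix x y z :: quat and a b :: real
  show "x + y + z = x + (y + z)" "x + y = y + x" "0 + x = x" "- x + x = 0" "x - y = x + - y"
    by (simp_all add: quat_ops quat.expand)
  show "x * y * z = x * (y * z)" "(x + y) * z = x * z + y * z" "x * (y + z) = x * y + x * z"
    by (simp_all add: quat_ops algebra_simps)
  show "1 * x = x" "x * 1 = x" "0 \<noteq> (1::quat)"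
    by (simp_all add: quat_ops quat.expand)
  show "a *\<^sub>R (x + y) = a *\<^sub>R x + a *\<^sub>R y" "(a + b) *\<^sub>R x = a *\<^sub>R x + b *\<^sub>R x"
    "a *\<^sub>R b *\<^sub>R x = (a * b) *\<^sub>R x" "1 *\<^sub>R x = x"
    "a *\<^sub>R x * y = a *\<^sub>R (x * y)" "x * a *\<^sub>R y = a *\<^sub>R (x * y)"
    by (simp_all add: quat_ops algebra_simps)
  show "inverse (0::quat) = 0"
    by (simp add: inverse_quat_def quat_ops)
  show "x div y = x * inverse y"
    by (rule divide_quat_def)
  assume "x \<noteq> 0"
  define N where "N = (q_re x)\<^sup>2 + (q_i x)\<^sup>2 + (q_j x)\<^sup>2 + (q_k x)\<^sup>2"
  have N: "N \<noteq> 0"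
    using \<open>x \<noteq> 0\<close> quat_normsq_eq_0[of x] by (simp add: N_def)
  show "inverse x * x = 1" "x * inverse x = 1"
    using N unfolding inverse_quat_def N_def[symmetric]
    by (simp_all add: quat_ops field_simps) (simp_all add: N_def power2_eq_square)
qed

end

class conj_real_div_algebra = real_div_algebra +
  fixes conjg :: "'a \<Rightarrow> 'a"
  assumes conjg_conjg [simp]: "conjg (conjg x) = x"
    and conjg_add: "conjg (x + y) = conjg x + conjg y"
    and conjg_mult: "conjg (x * y) = conjg y * conjg x"
    and conjg_scaleR: "conjg (r *\<^sub>R x) = r *\<^sub>R conjg x"

instantiation real :: conj_real_div_algebra
begin
definition conjg_real :: "real \<Rightarrow> real" where "conjg_real x = x"
instance by standard (simp_all add: conjg_real_def)
end

instantiation complex :: conj_real_div_algebra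
begin
definition conjg_complex :: "complex \<Rightarrow> complex" where "conjg_complex x = cnj x"
instance by standard (simp_all add: conjg_complex_def)
end

instantiation quat :: conj_real_div_algebra
begin
definition conjg_quat :: "quat \<Rightarrow> quat" where
  "conjg_quat x = Quat (q_re x) (- q_i x) (- q_j x) (- q_k x)"
instance by standard (simp_all add: conjg_quat_def quat_ops algebra_simps)
end


section \<open>Positive definite matrices\<close>

definition conj_transpose :: "'a::conj_real_div_algebra^'n^'m \<Rightarrow> 'a^'m^'n" where
  "conj_transpose X = (\<chi> i j. conjg (X $ j $ i))"

(* For X = X* the number v* X v is real; positivity is stated through the embedding of the reals. *)
definition pos_def_matrices :: "('a::conj_real_div_algebra^'n^'n) set" where
  "pos_def_matrices = {X. X = conj_transpose X \<and>
     (\<forall>v. v \<noteq> 0 \<longrightarrow> (\<exists>r>0. (\<Sum>i\<in>UNIV. conjg (v $ i) * (X *v v) $ i) = of_real r))}"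

definition diag_matrix :: "('n \<Rightarrow> real) \<Rightarrow> 'a::conj_real_div_algebra^'n^'n" where
  "diag_matrix d = (\<chi> i j. if i = j then of_real (d i) else 0)"

(* Meaningful for positive definite X, where the value does not depend on the choice of U and d. *)
definition matrix_powr ::
  "'a::conj_real_div_algebra^'n^'n \<Rightarrow> real \<Rightarrow> 'a^'n^'n" where
  "matrix_powr X t = (THE Y. \<exists>(U :: 'a^'n^'n) d. U ** conj_transpose U = mat 1 \<and> (\<forall>i. d i > 0) \<and>
     X = U ** diag_matrix d ** conj_transpose U \<and>
     Y = U ** diag_matrix (\<lambda>i. d i powr t) ** conj_transpose U)"

(* Right eigenvalues, v being a column vector; over a commutative algebra these are the usual ones. *)
definition spec :: "'a::conj_real_div_algebra^'n^'n \<Rightarrow> 'a set" where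
  "spec X = {l. \<exists>v. v \<noteq> 0 \<and> X *v v = (\<chi> i. v $ i * l)}"


section \<open>Geometric and Wasserstein means\<close>

definition geometric_mean ::
  "'a::conj_real_div_algebra^'n^'n \<Rightarrow> 'a^'n^'n \<Rightarrow> 'a^'n^'n" where
  "geometric_mean A B =
     matrix_powr A (1/2) **
     matrix_powr (matrix_powr A (-1/2) ** B ** matrix_powr A (-1/2)) (1/2) **
     matrix_powr A (1/2)"

definition wasserstein_mean ::
  "'a::conj_real_div_algebra^'n^'n \<Rightarrow> 'a^'n^'n \<Rightarrow> 'a^'n^'n" where
  "wasserstein_mean A B = (1/4) *\<^sub>R
     ((mat 1 + geometric_mean (matrix_inv A) B) ** A ** (mat 1 + geometric_mean (matrix_inv A) B))"

definition linearizable_wasserstein ::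
  "'a::conj_real_div_algebra^'n^'n \<Rightarrow> 'a^'n^'n \<Rightarrow> bool" where
  "linearizable_wasserstein A B \<longleftrightarrow>
     (\<exists>a b :: real. wasserstein_mean A B = a *\<^sub>R A + b *\<^sub>R B)"

end

theory Submission
  imports Defs
begin

text \<open>
  Let \<open>G\<close> be the geometric mean of \<open>A\<^sup>-\<^sup>1\<close> and \<open>B\<close>. It is positive definite and satisfies
  \<open>G A G = B\<close>, so the Wasserstein mean equals \<open>(A + B + G A + A G) / 4\<close>. Hence it is a
  real combination of \<open>A\<close> and \<open>B\<close> exactly if \<open>G A + A G = \<alpha> A + \<beta> G A G\<close> for some
  real \<open>\<alpha>\<close> and \<open>\<beta>\<close>.

  In a unitary basis of eigenvectors of \<open>G\<close>, with eigenvalues \<open>g\<^sub>i\<close>, this relation says that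
  \<open>g\<^sub>i + g\<^sub>j = \<alpha> + \<beta> g\<^sub>i g\<^sub>j\<close> wherever the entry of \<open>A\<close> in position \<open>(i, j)\<close> does not vanish.
  The diagonal entries of a positive definite matrix are positive, so all \<open>g\<^sub>i\<close> are roots
  of one quadratic polynomial and there are at most two of them; comparing the equations for
  \<open>(i, i)\<close>, \<open>(j, j)\<close> and \<open>(i, j)\<close> shows that \<open>A\<close> has no entry between different eigenspaces,
  that is, \<open>A\<close> and \<open>G\<close> commute (\<open>anticommutator_relation_imp\<close>). Conversely, if \<open>G\<close> has at most two
  eigenvalues, it satisfies a quadratic equation, and multiplying that equation by a matrix \<open>A\<close>
  commuting with \<open>G\<close> gives the relation (\<open>anticommutator_relation_exists\<close>).

  The argument is the same for the three kinds of scalars, and is carried out in a type class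
  \<open>star_division\<close> that contains them. It needs the spectral theorem there
  (\<open>pos_def_diagonalisation\<close>). A Hermitian matrix acts on column vectors as a real self-adjoint
  operator, so a maximiser of the Rayleigh quotient provides real eigenvalues without
  any determinants, and Householder reflections assemble the eigenvectors into a unitary matrix.
  That matrix powers are well defined and commute with whatever their argument commutes
  with is a consequence of the intertwining property \<open>intertwining_conj_diag\<close>.
\<close>

section \<open>Quaternions as a Euclidean space\<close>

text \<open>With the inner product of \<open>\<real>\<^sup>4\<close> the column vectors over the quaternions form a
  finite-dimensional Euclidean space, which gives the compactness of the unit sphere that the
  existence of eigenvectors rests on.\<close>

instantiation quat :: euclidean_space
begin

definition inner_quat :: "quat \<Rightarrow> quat \<Rightarrow> real" where
  "inner_quat x y = q_re x * q_re y + q_i x * q_i y + q_j x * q_j y + q_k x * q_k y"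

definition norm_quat :: "quat \<Rightarrow> real" where
  "norm_quat x = sqrt (x \<bullet> x)"

definition sgn_quat :: "quat \<Rightarrow> quat" where
  "sgn_quat x = x /\<^sub>R norm x"

definition dist_quat :: "quat \<Rightarrow> quat \<Rightarrow> real" where
  "dist_quat x y = norm (x - y)"

definition uniformity_quat :: "(quat \<times> quat) filter" where
  "uniformity_quat = (INF e\<in>{0 <..}. principal {(x, y). dist x y < e})"

definition open_quat :: "quat set \<Rightarrow> bool" where
  "open_quat U \<longleftrightarrow> (\<forall>x\<in>U. eventually (\<lambda>(x', y). x' = x \<longrightarrow> y \<in> U) uniformity)"

definition Basis_quat :: "quat set" where
  "Basis_quat = {Quat 1 0 0 0, Quat 0 1 0 0, Quat 0 0 1 0, Quat 0 0 0 1}"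

instance
proof
  fix x y z :: quat and r :: real
  show "x \<bullet> y = y \<bullet> x" "(x + y) \<bullet> z = x \<bullet> z + y \<bullet> z" "(r *\<^sub>R x) \<bullet> y = r * (x \<bullet> y)"
    by (simp_all add: inner_quat_def quat_ops algebra_simps)
  show "0 \<le> x \<bullet> x"
    by (simp add: inner_quat_def)
  show "x \<bullet> x = 0 \<longleftrightarrow> x = 0"
    using quat_normsq_eq_0[of x] by (simp add: inner_quat_def power2_eq_square)
  show "(\<forall>u\<in>Basis. x \<bullet> u = 0) \<longleftrightarrow> x = 0"
    by (cases x) (auto simp: Basis_quat_def inner_quat_def zero_quat_def)
next
  fix u v :: quat
  assume "u \<in> Basis" "v \<in> Basis"
  then show "u \<bullet> v = (if u = v then 1 else 0)"
    unfolding Basis_quat_def inner_quat_def by (elim insertE emptyE; simp)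
qed (rule dist_quat_def sgn_quat_def uniformity_quat_def open_quat_def norm_quat_def |
    simp add: Basis_quat_def)+

end

text \<open>The real, complex and quaternionic cases are treated at once. The single identity below links
  the conjugation to the real inner product; its polarisation says that the inner product is the
  real part of \<open>conjg x * y\<close>, which is what makes the conjugate transpose the real
  adjoint.\<close>

class star_division = conj_real_div_algebra + euclidean_space +
  assumes conjg_mult_self: "conjg x * x = (x \<bullet> x) *\<^sub>R 1"

instance real :: star_division
  by standard (simp add: conjg_real_def)

instance complex :: star_division
  by standard (simp add: conjg_complex_def complex_eq_iff inner_complex_def algebra_simps)

instance quat :: star_division
  by standard (simp add: conjg_quat_def inner_quat_def quat_ops algebra_simps)


section \<open>The Hermitian form and its real part\<close>

lemma conjg_0 [simp]: "conjg (0::'a::conj_real_div_algebra) = 0"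
  using conjg_scaleR[of 0 "0::'a"] by simp

lemma conjg_1 [simp]: "conjg (1::'a::conj_real_div_algebra) = 1"
  by (metis conjg_conjg conjg_mult mult.right_neutral)

lemma conjg_of_real [simp]: "conjg (of_real r :: 'a::conj_real_div_algebra) = of_real r"
  by (simp add: of_real_def conjg_scaleR)

lemma conjg_minus: "conjg (- x :: 'a::conj_real_div_algebra) = - conjg x"
  using conjg_scaleR[of "-1" x] by simp

lemma conjg_diff: "conjg (x - y :: 'a::conj_real_div_algebra) = conjg x - conjg y"
  using conjg_add[of x "-y"] by (simp add: conjg_minus)

lemma conjg_sum: "conjg (sum f S) = (\<Sum>i\<in>S. conjg (f i :: 'a::conj_real_div_algebra))"
  by (induction S rule: infinite_finite_induct) (simp_all add: conjg_add)

text \<open>In \<open>x * conjg x * x\<close> the inner product \<open>conjg x * x\<close> is a real scalar and moves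
  to the front; cancelling \<open>x\<close> gives the same value for the other order.\<close>

lemma mult_conjg_self: "x * conjg x = of_real (x \<bullet> x)" for x :: "'a::star_division"
proof (cases "x = 0")
  case False
  have "(x * conjg x) * x = of_real (x \<bullet> x) * x"
    by (simp add: mult.assoc conjg_mult_self of_real_def)
  with False show ?thesis by simp
qed simp

text \<open>Polarisation of \<open>conjg_mult_self\<close>.\<close>

lemma conjg_mult_add: "conjg x * y + conjg y * x = of_real (2 * (x \<bullet> y))"
  for x y :: "'a::star_division"
proof -
  have "conjg (x + y) * (x + y) = ((x + y) \<bullet> (x + y)) *\<^sub>R 1"
    by (rule conjg_mult_self)
  then show ?thesis
    by (simp add: conjg_add algebra_simps inner_add conjg_mult_self inner_commute of_real_def
      scaleR_2 scaleR_left_distrib mult_2)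
qed

lemma inner_mult_left: "(a * x) \<bullet> y = x \<bullet> (conjg a * y)" for x y a :: "'a::star_division"
proof -
  have "of_real (2 * ((a * x) \<bullet> y)) = (of_real (2 * (x \<bullet> (conjg a * y))) :: 'a)"
    by (simp only: conjg_mult_add[symmetric]) (simp add: conjg_mult mult.assoc)
  then show ?thesis by (simp only: of_real_eq_iff)
qed

lemma inner_1_of_real [simp]: "1 \<bullet> (of_real r :: 'a::star_division) = r"
proof -
  have "of_real (1 \<bullet> (1::'a)) = (1::'a)"
    using conjg_mult_self[of "1::'a"] by (simp add: of_real_def)
  then have "1 \<bullet> (1::'a) = 1" by (metis of_real_eq_1_iff)
  then show ?thesis by (simp add: of_real_def)
qed

lemma inner_eq_inner_1: "x \<bullet> y = 1 \<bullet> (conjg x * y)" for x y :: "'a::star_division"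
  using inner_mult_left[of x 1 y] by simp

lemma self_conjg_imp_of_real:
  fixes z :: "'a::star_division"
  assumes "conjg z = z" shows "z = of_real (1 \<bullet> z)"
proof -
  have "z + z = of_real (1 \<bullet> z) + of_real (1 \<bullet> z)"
    using conjg_mult_add[of 1 z] assms by (simp flip: mult_2)
  then show ?thesis by (simp flip: scaleR_2)
qed

lemma conj_transpose_conj_transpose [simp]: "conj_transpose (conj_transpose X) = X"
  by (simp add: conj_transpose_def vec_eq_iff)

lemma conj_transpose_mult: "conj_transpose (X ** Y) = conj_transpose Y ** conj_transpose X"
  by (simp add: conj_transpose_def vec_eq_iff matrix_matrix_mult_def conjg_sum conjg_mult)

lemma conj_transpose_mat_1 [simp]: "conj_transpose (mat 1) = mat 1"
  by (simp add: conj_transpose_def vec_eq_iff mat_def)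

text \<open>This makes every Hermitian matrix a real self-adjoint operator, so that its eigenvectors
  can be found by real methods although the scalars need not commute.\<close>

lemma inner_matrix_vector: "(X *v x) \<bullet> y = x \<bullet> (conj_transpose X *v y)"
  for X :: "'a::star_division^'n^'m"
proof -
  have "(X *v x) \<bullet> y = (\<Sum>i\<in>UNIV. \<Sum>k\<in>UNIV. x $ k \<bullet> (conjg (X $ i $ k) * y $ i))"
    by (simp add: inner_vec_def matrix_vector_mult_def inner_sum_left inner_mult_left)
  also have "\<dots> = x \<bullet> (conj_transpose X *v y)"
    by (subst sum.swap) (simp add: inner_vec_def matrix_vector_mult_def conj_transpose_def
      inner_sum_right)
  finally show ?thesis .
qed

text \<open>For a Hermitian matrix the number \<open>v\<^sup>* X v\<close> equals its own conjugate, hence is real, and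
  its real part is the inner product. From here on positivity is a statement about the real
  inner product only.\<close>

lemma pos_def_matrices_iff:
  fixes X :: "'a::star_division^'n^'n"
  shows "X \<in> pos_def_matrices \<longleftrightarrow>
    conj_transpose X = X \<and> (\<forall>v. v \<noteq> 0 \<longrightarrow> v \<bullet> (X *v v) > 0)"
proof -
  let ?q = "\<lambda>v. \<Sum>i\<in>UNIV. conjg (v $ i) * (X *v v) $ i"
  have re: "1 \<bullet> ?q v = v \<bullet> (X *v v)" for v
    by (simp add: inner_sum_right inner_vec_def inner_eq_inner_1[symmetric])
  have real: "?q v = of_real (v \<bullet> (X *v v))" if X: "conj_transpose X = X" for v
  proof -
    have X': "conjg (X $ k $ i) = X $ i $ k" for i k
      by (subst (2) X[symmetric]) (simp add: conj_transpose_def)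
    have "conjg (?q v) = (\<Sum>i\<in>UNIV. \<Sum>k\<in>UNIV. conjg (v $ k) * (X $ k $ i * v $ i))"
      by (simp add: conjg_sum conjg_mult matrix_vector_mult_def X' sum_distrib_right mult.assoc)
    also have "\<dots> = ?q v"
      by (subst sum.swap) (simp add: matrix_vector_mult_def sum_distrib_left)
    finally have "?q v = of_real (1 \<bullet> ?q v)"
      by (rule self_conjg_imp_of_real)
    then show ?thesis
      by (simp only: re)
  qed
  have "(\<exists>r>0. ?q v = of_real r) \<longleftrightarrow> v \<bullet> (X *v v) > 0" if "conj_transpose X = X" for v
    unfolding real[OF that] of_real_eq_iff by auto
  then show ?thesis
    unfolding pos_def_matrices_def mem_Collect_eq by metis
qed

lemma matrix_add_rdistrib: "(A + B) ** C = A ** C + B ** C"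
  by (simp add: matrix_matrix_mult_def vec_eq_iff distrib_right sum.distrib)

lemma matrix_diff_ldistrib: "A ** (B - C) = A ** B - A ** (C :: 'a::ring_1^'n^'m)"
  by (simp add: matrix_matrix_mult_def vec_eq_iff right_diff_distrib sum_subtractf)

lemma matrix_diff_rdistrib: "(A - B) ** C = A ** C - (B :: 'a::ring_1^'n^'m) ** C"
  by (simp add: matrix_matrix_mult_def vec_eq_iff left_diff_distrib sum_subtractf)

text \<open>Over a skew field, in general, neither determinants nor the trace identity
  \<open>tr (X Y) = tr (Y X)\<close> are available. The identity does hold for \<open>Y = X\<^sup>*\<close>, both sides
  being the sum of the squared lengths of the entries. Now \<open>P = U\<^sup>* U\<close> is a Hermitian projection, and
  so is \<open>Z = 1 - P\<close>. As \<open>P\<close> has the trace of \<open>U U\<^sup>* = 1\<close>, the trace of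
  \<open>Z = Z Z\<^sup>*\<close> vanishes, and then so do all entries of \<open>Z\<close>.\<close>

lemma unitary_left_inverse:
  fixes U :: "'a::star_division^'n^'n"
  assumes U: "U ** conj_transpose U = mat 1"
  shows "conj_transpose U ** U = mat 1"
proof -
  define tr where "tr Y = (\<Sum>i\<in>UNIV. Y $ i $ i)" for Y :: "'a^'n^'n"
  have tr: "tr (Y ** conj_transpose Y) = of_real (\<Sum>i\<in>UNIV. \<Sum>k\<in>UNIV. Y $ i $ k \<bullet> Y $ i $ k)" for Y
    by (simp add: tr_def matrix_matrix_mult_def conj_transpose_def mult_conjg_self)
  have tr': "tr (conj_transpose Y ** Y) = tr (Y ** conj_transpose Y)" for Y
    unfolding tr by (subst sum.swap)
      (simp add: tr_def matrix_matrix_mult_def conj_transpose_def conjg_mult_self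
        flip: of_real_def)
  define P where "P = conj_transpose U ** U"
  define Z where "Z = mat 1 - P"
  have PP: "P ** P = P"
    by (metis P_def U matrix_mul_assoc matrix_mul_lid)
  have Pc: "conj_transpose P = P"
    by (simp add: P_def conj_transpose_mult)
  have Zc: "conj_transpose Z = Z"
    using Pc by (simp add: Z_def conj_transpose_def vec_eq_iff mat_def conjg_diff)
  have ZZ: "Z ** Z = Z"
    by (simp add: Z_def matrix_diff_ldistrib matrix_diff_rdistrib PP)
  have "tr Z = tr (mat 1) - tr P"
    by (simp add: Z_def tr_def sum_subtractf)
  also have "tr P = tr (mat 1)"
    using tr'[of U] U by (simp add: P_def)
  finally have "tr (Z ** conj_transpose Z) = 0"
    by (simp add: Zc ZZ)
  then have "(\<Sum>i\<in>UNIV. \<Sum>k\<in>UNIV. Z $ i $ k \<bullet> Z $ i $ k) = 0"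
    unfolding tr by (simp only: of_real_eq_0_iff)
  then have "Z = 0"
    by (simp add: sum_nonneg_eq_0_iff sum_nonneg vec_eq_iff)
  then show ?thesis by (simp add: Z_def P_def)
qed


section \<open>Spectral theorem\<close>

text \<open>A maximiser of the quadratic form \<open>v \<bullet> T v\<close> on the unit sphere of \<open>W\<close> is an
  eigenvector: moving it along the residual \<open>r = l u - T u\<close> would otherwise increase the
  Rayleigh quotient to first order.\<close>

lemma self_adjoint_eigenvector:
  fixes T :: "'b::euclidean_space \<Rightarrow> 'b"
  assumes T: "linear T" and W: "subspace W" "W \<noteq> {0}" and inv: "\<And>v. v \<in> W \<Longrightarrow> T v \<in> W"
    and sa: "\<And>v w. T v \<bullet> w = v \<bullet> T w"
  obtains v l where "v \<in> W" "norm v = 1" "T v = l *\<^sub>R v"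
proof -
  let ?S = "sphere 0 1 \<inter> W"
  obtain w where w: "w \<in> W" "w \<noteq> 0"
    using W subspace_0 by blast
  then have "w /\<^sub>R norm w \<in> ?S"
    using W by (simp add: subspace_scale)
  then have "?S \<noteq> {}" by blast
  moreover have "compact ?S"
    using W by (simp add: closed_subspace compact_Int_closed)
  moreover have "continuous_on ?S (\<lambda>v. v \<bullet> T v)"
    using T by (intro continuous_intros linear_continuous_on) (simp add: linear_conv_bounded_linear)
  ultimately have "\<exists>u\<in>?S. \<forall>v\<in>?S. v \<bullet> T v \<le> u \<bullet> T u"
    by (intro continuous_attains_sup)
  then obtain u where u: "u \<in> ?S" and max: "\<And>v. v \<in> ?S \<Longrightarrow> v \<bullet> T v \<le> u \<bullet> T u"
    by blast
  define l where "l = u \<bullet> T u"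
  have le: "v \<bullet> T v \<le> l * (v \<bullet> v)" if v: "v \<in> W" for v
  proof (cases "v = 0")
    case True
    then show ?thesis by simp
  next
    case False
    have "(v /\<^sub>R norm v) \<bullet> T (v /\<^sub>R norm v) \<le> l"
      unfolding l_def using v False W by (intro max) (simp add: subspace_scale)
    moreover have "(v /\<^sub>R norm v) \<bullet> T (v /\<^sub>R norm v) = v \<bullet> T v / (v \<bullet> v)"
      using T by (simp add: linear_cmul dot_square_norm power2_eq_square divide_simps)
    ultimately have "v \<bullet> T v / (v \<bullet> v) \<le> l"
      by simp
    then show ?thesis
      using False by (simp add: pos_divide_le_eq inner_gt_zero_iff)
  qed
  define r where "r = l *\<^sub>R u - T u"
  have uW: "u \<in> W" and uu: "u \<bullet> u = 1"
    using u by (auto simp: dot_square_norm)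
  have rW: "r \<in> W"
    using W uW inv[OF uW] by (simp add: r_def subspace_diff subspace_scale)
  define d where "d = l * (r \<bullet> r) - r \<bullet> T r"
  have d: "d \<ge> 0"
    using le[OF rW] by (simp add: d_def)
  have pos: "0 \<le> 2 * t * (r \<bullet> r) + t\<^sup>2 * d" for t
  proof -
    have "(u + t *\<^sub>R r) \<bullet> T (u + t *\<^sub>R r) \<le> l * ((u + t *\<^sub>R r) \<bullet> (u + t *\<^sub>R r))"
      using W uW rW by (intro le) (simp add: subspace_add subspace_scale)
    also have "(u + t *\<^sub>R r) \<bullet> (u + t *\<^sub>R r) = 1 + 2 * t * (r \<bullet> u) + t\<^sup>2 * (r \<bullet> r)"
      using uu by (simp add: inner_add power2_eq_square inner_commute)
    also have "(u + t *\<^sub>R r) \<bullet> T (u + t *\<^sub>R r) = l + 2 * t * (r \<bullet> T u) + t\<^sup>2 * (r \<bullet> T r)"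
      using T sa[of u r] sa[of r u]
      by (simp add: linear_add linear_cmul inner_add l_def power2_eq_square inner_commute)
    also have "r \<bullet> T u = l * (r \<bullet> u) - r \<bullet> r"
    proof -
      have "T u = l *\<^sub>R u - r"
        by (simp add: r_def)
      then show ?thesis
        by (simp only: inner_diff_right inner_scaleR_right)
    qed
    finally show ?thesis
      by (simp add: d_def algebra_simps)
  qed
  have "r \<bullet> r = 0"
  proof (rule ccontr)
    assume "r \<bullet> r \<noteq> 0"
    then have c: "r \<bullet> r > 0" by (simp add: inner_gt_zero_iff)
    \<comment> \<open>A step in direction \<open>- r\<close> short enough that the quadratic term, of coefficient
      \<open>d\<close>, stays below the linear one.\<close>
    define s where "s = (r \<bullet> r) / (d + 1)"
    have s: "s > 0" "r \<bullet> r = s * (d + 1)"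
      using c d by (simp_all add: s_def)
    have "2 * (- s) * (r \<bullet> r) + (- s)\<^sup>2 * d = - (s\<^sup>2 * (d + 2))"
      unfolding s(2) by (simp add: algebra_simps power2_eq_square)
    also have "\<dots> < 0"
      using s(1) d by simp
    finally show False
      using pos[of "- s"] by linarith
  qed
  then have "T u = l *\<^sub>R u"
    by (simp add: r_def)
  then show thesis
    using that uW uu by (metis norm_eq_1)
qed

lemma scaleR_matrix_vector: "(r *\<^sub>R A) *v x = r *\<^sub>R (A *v x)"
  for A :: "'a::real_algebra_1^'n^'m"
  by (simp add: matrix_vector_mult_def vec_eq_iff scaleR_sum_right)

lemma matrix_vector_axis: "(X *v axis j 1) $ i = X $ i $ j" for X :: "'a::semiring_1^'n^'m"
  by (simp add: matrix_vector_mult_def axis_def if_distrib cong: if_cong)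

text \<open>The Householder reflection exchanging the unit vectors \<open>v\<close> and \<open>axis j 1\<close>. When
  \<open>v\<close> is not the \<open>j\<close>-th unit vector, it is the reflection in the hyperplane orthogonal to their
  difference \<open>w\<close>. Realness of \<open>v $ j\<close> is essential: the reflection preserves the Hermitian form,
  hence maps one to the other only if their Hermitian product \<open>v\<^sub>j\<close> equals its conjugate.\<close>

lemma reflection_exists:
  fixes v :: "'a::star_division^'n"
  assumes v: "norm v = 1" and vj: "v $ j = of_real r"
  obtains H where "conj_transpose H = H" "H ** H = mat 1" "H *v axis j 1 = v"
    "\<And>i. i \<noteq> j \<Longrightarrow> v $ i = 0 \<Longrightarrow> H *v axis i 1 = axis i 1"
proof (cases "v = axis j 1")
  case True
  then show ?thesis
    using that[of "mat 1"] by simp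
next
  case False
  define w where "w = v - axis j 1"
  define c where "c = 2 / (w \<bullet> w)"
  define P :: "'a^'n^'n" where "P = (\<chi> i k. w $ i * conjg (w $ k))"
  define H where "H = mat 1 - c *\<^sub>R P"
  have w0: "w \<bullet> w \<noteq> 0"
    using False by (simp add: w_def)
  have vv: "v \<bullet> v = 1"
    using v by (simp add: norm_eq_1)
  have "v \<bullet> axis j 1 = r"
    by (simp add: inner_axis vj inner_commute)
  moreover have "axis j 1 \<bullet> (axis j 1 :: 'a^'n) = 1"
    using inner_1_of_real[of 1, where 'a = 'a] by (simp add: inner_axis_axis)
  ultimately have ww: "w \<bullet> w = 2 * (1 - r)"
    by (simp add: w_def inner_diff vv inner_commute)
  have PP: "P ** P = (w \<bullet> w) *\<^sub>R P"
  proof -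
    have "(P ** P) $ i $ l = ((w \<bullet> w) *\<^sub>R P) $ i $ l" for i l
    proof -
      have "(P ** P) $ i $ l = (\<Sum>k\<in>UNIV. w $ i * ((conjg (w $ k) * w $ k) * conjg (w $ l)))"
        by (simp add: P_def matrix_matrix_mult_def mult.assoc)
      also have "\<dots> = ((w \<bullet> w) *\<^sub>R P) $ i $ l"
        by (simp add: conjg_mult_self P_def inner_vec_def scaleR_sum_left)
      finally show ?thesis .
    qed
    then show ?thesis by (simp add: vec_eq_iff)
  qed
  have "P ** (c *\<^sub>R P) = 2 *\<^sub>R P"
    using w0 by (simp add: matrix_scalar_ac PP c_def scalar_matrix_assoc[symmetric])
  then have HH: "H ** H = mat 1"
    by (simp add: H_def matrix_diff_ldistrib matrix_diff_rdistrib scalar_matrix_assoc[symmetric]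
      scaleR_2 scaleR_right_distrib)
  have Hc: "conj_transpose H = H"
    by (simp add: H_def P_def conj_transpose_def vec_eq_iff mat_def conjg_diff conjg_scaleR
      conjg_mult)
  have Hx: "H *v axis i 1 = axis i 1 - (\<chi> k. c *\<^sub>R (w $ k * conjg (w $ i)))" for i
    by (simp add: H_def P_def vec_eq_iff matrix_vector_mult_diff_rdistrib scaleR_matrix_vector
      matrix_vector_axis)
  have wj: "w $ j = of_real (r - 1)"
    by (simp add: w_def vj)
  have "c * (r - 1) = -1"
    using w0 by (simp add: c_def ww divide_simps)
  then have "H *v axis j 1 = axis j 1 + w"
    unfolding Hx wj conjg_of_real by (simp add: vec_eq_iff of_real_def)
  moreover have "H *v axis i 1 = axis i 1" if "i \<noteq> j" "v $ i = 0" for i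
    unfolding Hx using that by (simp add: w_def axis_def vec_eq_iff)
  ultimately show ?thesis
    using that[OF Hc HH] by (simp add: w_def)
qed

text \<open>The coordinates are diagonalised one after the other, which keeps the size of the matrix
  fixed. If the coordinates in \<open>S\<close> are already diagonalised for \<open>Y = U\<^sup>* X U\<close>, the vectors vanishing
  on \<open>S\<close> form an invariant subspace, by Hermitian symmetry of \<open>Y\<close>. An eigenvector in that
  subspace is moved to the coordinate \<open>j\<close> by a reflection, which fixes the coordinates in
  \<open>S\<close> because the eigenvector vanishes there.\<close>

lemma hermitian_diagonalisable_on:
  fixes X :: "'a::star_division^'n^'n"
  assumes X: "conj_transpose X = X"
  shows "\<exists>U :: 'a^'n^'n. U ** conj_transpose U = mat 1 \<and> conj_transpose U ** U = mat 1 \<and>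
    (\<forall>i\<in>S. \<exists>l. (conj_transpose U ** X ** U) *v axis i 1 = l *\<^sub>R axis i 1)"
  using finite[of S]
proof (induction S rule: finite_induct)
  case empty
  show ?case
    by (rule exI[of _ "mat 1 :: 'a^'n^'n"]) simp
next
  case (insert j S)
  then obtain U :: "'a^'n^'n" where U: "U ** conj_transpose U = mat 1" "conj_transpose U ** U = mat 1"
    and diag: "\<And>i. i \<in> S \<Longrightarrow> \<exists>l. (conj_transpose U ** X ** U) *v axis i 1 = l *\<^sub>R axis i 1"
    by blast
  define Y where "Y = conj_transpose U ** X ** U"
  have Y: "conj_transpose Y = Y"
    by (simp add: Y_def conj_transpose_mult X matrix_mul_assoc)
  define W :: "('a^'n) set" where "W = {v. \<forall>i\<in>S. v $ i = 0}"
  have "subspace W"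
    by (auto simp: W_def subspace_def)
  moreover have "axis j 1 \<in> W" "axis j 1 \<noteq> (0 :: 'a^'n)"
    using insert.hyps by (auto simp: W_def axis_def vec_eq_iff)
  then have "W \<noteq> {0}"
    by blast
  moreover have "Y *v v \<in> W" if v: "v \<in> W" for v
  proof -
    have "(Y *v v) $ i = 0" if i: "i \<in> S" for i
    proof -
      obtain l where "Y *v axis i 1 = l *\<^sub>R axis i 1"
        using diag[OF i] Y_def by blast
      then have "Y $ k $ i = l *\<^sub>R axis i 1 $ k" for k
        by (metis matrix_vector_axis vector_scaleR_component)
      moreover have "Y $ i $ k = conjg (Y $ k $ i)" for k
        by (subst Y[symmetric]) (simp add: conj_transpose_def)
      ultimately have "Y $ i $ k * v $ k = 0" for k
        using v i by (cases "k = i") (auto simp: W_def axis_def)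
      then show ?thesis by (simp add: matrix_vector_mult_def del: mult_eq_0_iff)
    qed
    then show ?thesis by (simp add: W_def)
  qed
  moreover have "(Y *v v) \<bullet> w = v \<bullet> (Y *v w)" for v w
    by (simp add: inner_matrix_vector Y)
  ultimately obtain v l where v: "v \<in> W" "norm v = 1" "Y *v v = l *\<^sub>R v"
    using self_adjoint_eigenvector[OF matrix_vector_mul_linear] by metis
  \<comment> \<open>Multiplication by the unit scalar \<open>q\<close> on the right commutes with \<open>Y\<close> and with the real
    factor \<open>l\<close>; it makes the coordinate \<open>j\<close> of the eigenvector real.\<close>
  define q where "q = (if v $ j = 0 then 1 else conjg (v $ j) /\<^sub>R norm (v $ j))"
  define u where "u = (\<chi> i. v $ i * q)"
  have q: "q * conjg q = 1"
    by (simp add: q_def conjg_scaleR conjg_mult_self dot_square_norm power2_eq_square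
      field_simps)
  have q': "inner (x * q) (x * q) = x \<bullet> x" for x
  proof -
    have "of_real (inner (x * q) (x * q)) = (x * q) * conjg (x * q)"
      by (rule mult_conjg_self[symmetric])
    also have "\<dots> = x * (q * conjg q) * conjg x"
      by (simp only: conjg_mult mult.assoc)
    also have "\<dots> = of_real (x \<bullet> x)"
      by (simp only: q mult_1_right) (rule mult_conjg_self)
    finally show ?thesis
      by (simp only: of_real_eq_iff)
  qed
  have u1: "norm u = 1"
    using v(2) by (simp add: norm_eq_1 inner_vec_def u_def q')
  have uW: "u \<in> W"
    using v(1) by (simp add: W_def u_def)
  have uj: "u $ j = of_real (norm (v $ j))"
    by (simp add: u_def q_def mult_conjg_self dot_square_norm power2_eq_square)
       (simp add: of_real_def)
  have Yu: "Y *v u = l *\<^sub>R u"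
  proof -
    have "(Y *v u) $ i = (Y *v v) $ i * q" for i
      by (simp add: matrix_vector_mult_def u_def sum_distrib_right mult.assoc)
    then show ?thesis
      by (simp add: v(3) vec_eq_iff u_def)
  qed
  obtain H where H: "conj_transpose H = H" "H ** H = mat 1" "H *v axis j 1 = u"
    "\<And>i. i \<noteq> j \<Longrightarrow> u $ i = 0 \<Longrightarrow> H *v axis i 1 = axis i 1"
    using reflection_exists[OF u1 uj] by metis
  have HY: "(conj_transpose (U ** H) ** X ** (U ** H)) *v x = H *v (Y *v (H *v x))" for x
    by (simp add: conj_transpose_mult H Y_def matrix_vector_mul_assoc matrix_mul_assoc)
  have HS: "H *v axis i 1 = axis i 1" if "i \<in> S" for i
    using that uW insert.hyps by (intro H(4)) (auto simp: W_def)
  have "H *v u = axis j 1"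
    by (simp add: H(2) H(3)[symmetric] matrix_vector_mul_assoc)
  then have "(conj_transpose (U ** H) ** X ** (U ** H)) *v axis j 1 = l *\<^sub>R axis j 1"
    unfolding HY H(3) Yu by (simp add: linear_cmul[OF matrix_vector_mul_linear])
  moreover have "\<exists>m. (conj_transpose (U ** H) ** X ** (U ** H)) *v axis i 1 = m *\<^sub>R axis i 1"
    if i: "i \<in> S" for i
  proof -
    obtain m where "Y *v axis i 1 = m *\<^sub>R axis i 1"
      using diag[OF i] Y_def by blast
    then have "H *v (Y *v (H *v axis i 1)) = m *\<^sub>R axis i 1"
      by (simp add: HS[OF i] linear_cmul[OF matrix_vector_mul_linear])
    then show ?thesis
      unfolding HY by blast
  qed
  moreover have "(U ** H) ** conj_transpose (U ** H) = mat 1"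
    by (metis H(1,2) U(1) conj_transpose_mult matrix_mul_assoc matrix_mul_rid)
  moreover have "conj_transpose (U ** H) ** (U ** H) = mat 1"
    by (metis H(1,2) U(2) conj_transpose_mult matrix_mul_assoc matrix_mul_rid)
  ultimately show ?case
    by blast
qed


section \<open>Functions of a diagonalised matrix\<close>

definition conj_diag ::
  "'a::conj_real_div_algebra^'n^'n \<Rightarrow> ('n \<Rightarrow> real) \<Rightarrow> 'a^'n^'n" where
  "conj_diag U d = U ** diag_matrix d ** conj_transpose U"

lemma axis_nth_if: "axis i x $ k = (if k = i then x else 0)"
  by (simp add: axis_def)

lemma matrix_mult_diag_nth: "(M ** diag_matrix d) $ i $ j = d j *\<^sub>R M $ i $ j"
  by (simp add: matrix_matrix_mult_def diag_matrix_def of_real_def if_distrib cong: if_cong)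

lemma diag_mult_matrix_nth: "(diag_matrix d ** M) $ i $ j = d i *\<^sub>R M $ i $ j"
  by (simp add: matrix_matrix_mult_def diag_matrix_def of_real_def if_distrib if_distribR
    cong: if_cong)

lemma diag_matrix_mult: "diag_matrix d ** diag_matrix e = diag_matrix (\<lambda>i. d i * e i)"
  unfolding vec_eq_iff matrix_mult_diag_nth by (simp add: diag_matrix_def of_real_def mult.commute)

lemma conj_transpose_diag [simp]: "conj_transpose (diag_matrix d) = diag_matrix d"
  by (simp add: conj_transpose_def diag_matrix_def vec_eq_iff)

lemma conj_transpose_conj_diag [simp]: "conj_transpose (conj_diag U d) = conj_diag U d"
  by (simp add: conj_diag_def conj_transpose_mult matrix_mul_assoc)

text \<open>Entry \<open>(i, j)\<close> of the hypothesis says that \<open>M $ i $ j\<close> vanishes unless \<open>d j = e i\<close>, a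
  condition that applying a function to both sides preserves. The independence of a
  matrix power from the chosen diagonalisation, and the fact that it commutes with every matrix
  commuting with its argument, both follow from this.\<close>

lemma intertwining_diag:
  assumes "M ** diag_matrix d = diag_matrix e ** M"
  shows "M ** diag_matrix (\<lambda>i. f (d i)) = diag_matrix (\<lambda>i. f (e i)) ** M"
proof -
  have "f (d j) *\<^sub>R M $ i $ j = f (e i) *\<^sub>R M $ i $ j" for i j
  proof -
    have "d j *\<^sub>R M $ i $ j = e i *\<^sub>R M $ i $ j"
      by (metis assms diag_mult_matrix_nth matrix_mult_diag_nth)
    then show ?thesis by auto
  qed
  then show ?thesis
    by (simp add: vec_eq_iff matrix_mult_diag_nth diag_mult_matrix_nth)
qed

lemma intertwining_conj_diag:
  fixes U V Z :: "'a::star_division^'n^'n"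
  assumes U: "U ** conj_transpose U = mat 1" and V: "V ** conj_transpose V = mat 1"
    and Z: "Z ** conj_diag U d = conj_diag V e ** Z"
  shows "Z ** conj_diag U (\<lambda>i. f (d i)) = conj_diag V (\<lambda>i. f (e i)) ** Z"
proof -
  note U' = unitary_left_inverse[OF U] and V' = unitary_left_inverse[OF V]
  define M where "M = conj_transpose V ** Z ** U"
  have VM: "V ** M = Z ** U"
    by (simp add: M_def matrix_mul_assoc V)
  have MU: "M ** conj_transpose U = conj_transpose V ** Z"
    by (simp add: M_def matrix_mul_assoc[symmetric] U)
  have "M ** diag_matrix d = conj_transpose V ** (Z ** conj_diag U d) ** U"
    by (simp add: M_def conj_diag_def matrix_mul_assoc[symmetric] U')
  also have "\<dots> = diag_matrix e ** M"
    unfolding Z by (simp add: M_def conj_diag_def matrix_mul_assoc V')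
  finally have "M ** diag_matrix (\<lambda>i. f (d i)) = diag_matrix (\<lambda>i. f (e i)) ** M"
    by (rule intertwining_diag)
  then have "V ** (M ** diag_matrix (\<lambda>i. f (d i))) ** conj_transpose U
      = V ** (diag_matrix (\<lambda>i. f (e i)) ** M) ** conj_transpose U"
    by simp
  then have "Z ** U ** diag_matrix (\<lambda>i. f (d i)) ** conj_transpose U
      = V ** diag_matrix (\<lambda>i. f (e i)) ** (M ** conj_transpose U)"
    by (simp add: matrix_mul_assoc VM)
  then show ?thesis
    by (simp add: conj_diag_def MU matrix_mul_assoc)
qed

lemma conj_diag_mult:
  fixes U :: "'a::star_division^'n^'n"
  assumes U: "U ** conj_transpose U = mat 1"
  shows "conj_diag U d ** conj_diag U e = conj_diag U (\<lambda>i. d i * e i)"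
proof -
  have "conj_diag U d ** conj_diag U e
      = U ** (diag_matrix d ** (conj_transpose U ** U) ** diag_matrix e) ** conj_transpose U"
    by (simp add: conj_diag_def matrix_mul_assoc)
  then show ?thesis
    by (simp add: unitary_left_inverse[OF U] diag_matrix_mult conj_diag_def)
qed

lemma conj_diag_1: "U ** conj_transpose U = mat 1 \<Longrightarrow> conj_diag U (\<lambda>i. 1) = mat 1"
  by (simp add: conj_diag_def diag_matrix_def flip: mat_def)

lemma pos_def_conj_diag:
  fixes U :: "'a::star_division^'n^'n"
  assumes U: "U ** conj_transpose U = mat 1" and d: "\<And>i. d i > 0"
  shows "conj_diag U d \<in> pos_def_matrices"
proof -
  have "v \<bullet> (conj_diag U d *v v) > 0" if v: "v \<noteq> 0" for v
  proof -
    define w where "w = conj_transpose U *v v"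
    have "U *v w = v"
      by (simp add: w_def matrix_vector_mul_assoc U)
    with v have "w \<noteq> 0"
      by auto
    then obtain k where k: "w $ k \<noteq> 0"
      by (auto simp: vec_eq_iff)
    have "v \<bullet> (conj_diag U d *v v) = w \<bullet> (diag_matrix d *v w)"
      using inner_matrix_vector[of "conj_transpose U" v "diag_matrix d *v w"]
      by (simp add: conj_diag_def w_def matrix_vector_mul_assoc matrix_mul_assoc)
    also have "\<dots> = (\<Sum>i\<in>UNIV. d i * (w $ i \<bullet> w $ i))"
      by (simp add: inner_vec_def matrix_vector_mult_def diag_matrix_def of_real_def if_distrib
        if_distribR cong: if_cong)
    also have "\<dots> > 0"
      using d k by (intro sum_pos2[of _ k]) (simp_all add: less_imp_le inner_gt_zero_iff)
    finally show ?thesis .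
  qed
  then show ?thesis
    by (simp add: pos_def_matrices_iff)
qed

text \<open>The spectral theorem. The values \<open>d i\<close> are positive, being the values of the quadratic
  form at the columns of \<open>U\<close>.\<close>

lemma pos_def_diagonalisation:
  fixes X :: "'a::star_division^'n^'n"
  assumes X: "X \<in> pos_def_matrices"
  obtains U d where "U ** conj_transpose U = mat 1" "\<And>i. d i > 0" "X = conj_diag U d"
proof -
  have Xc: "conj_transpose X = X" and Xp: "\<And>v. v \<noteq> 0 \<Longrightarrow> v \<bullet> (X *v v) > 0"
    using X by (auto simp: pos_def_matrices_iff)
  obtain U :: "'a^'n^'n" where U: "U ** conj_transpose U = mat 1" "conj_transpose U ** U = mat 1"
    and "\<forall>i. \<exists>l. (conj_transpose U ** X ** U) *v axis i 1 = l *\<^sub>R axis i 1"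
    using hermitian_diagonalisable_on[OF Xc, of UNIV] by blast
  then obtain d where d: "\<And>i. (conj_transpose U ** X ** U) *v axis i 1 = d i *\<^sub>R axis i 1"
    by metis
  have "(conj_transpose U ** X ** U) $ k $ i = (diag_matrix d :: 'a^'n^'n) $ k $ i" for k i
    using d[of i] by (auto simp: vec_eq_iff matrix_vector_axis diag_matrix_def axis_nth_if of_real_def)
  then have D: "conj_transpose U ** X ** U = diag_matrix d"
    by (simp add: vec_eq_iff)
  have "X = U ** (conj_transpose U ** X ** U) ** conj_transpose U"
    by (metis U(1) matrix_mul_assoc matrix_mul_lid matrix_mul_rid)
  then have "X = conj_diag U d"
    by (simp only: D conj_diag_def)
  moreover have "d i > 0" for i
  proof -
    have 1: "axis i 1 \<noteq> (0::'a^'n)"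
      by (simp add: axis_def vec_eq_iff)
    then have "U *v axis i 1 \<noteq> 0"
      by (metis U(2) matrix_vector_mul_assoc matrix_vector_mul_lid matrix_vector_mult_0_right)
    then have "(U *v axis i 1) \<bullet> (X *v (U *v axis i 1)) > 0"
      by (rule Xp)
    also have "(U *v axis i 1) \<bullet> (X *v (U *v axis i 1)) = d i * (axis i 1 \<bullet> (axis i 1 :: 'a^'n))"
      by (simp add: inner_matrix_vector matrix_vector_mul_assoc matrix_mul_assoc d)
    finally have "0 < d i * (axis i 1 \<bullet> (axis i 1 :: 'a^'n))" .
    moreover have "0 < axis i 1 \<bullet> (axis i 1 :: 'a^'n)"
      using 1 by (simp only: inner_gt_zero_iff not_False_eq_True)
    ultimately show ?thesis
      by (rule zero_less_mult_pos2)
  qed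
  ultimately show ?thesis
    using that U(1) by blast
qed

section \<open>Real powers\<close>

text \<open>Uniqueness of the value is the intertwining property of the identity matrix between two
  diagonalisations of the same matrix.\<close>

lemma matrix_powr_conj_diag:
  fixes U :: "'a::star_division^'n^'n"
  assumes U: "U ** conj_transpose U = mat 1" and d: "\<And>i. d i > 0"
  shows "matrix_powr (conj_diag U d) t = conj_diag U (\<lambda>i. d i powr t)"
  unfolding matrix_powr_def
proof (rule the_equality)
  show "\<exists>(V :: 'a^'n^'n) e. V ** conj_transpose V = mat 1 \<and> (\<forall>i. 0 < e i) \<and>
     conj_diag U d = V ** diag_matrix e ** conj_transpose V \<and>
     conj_diag U (\<lambda>i. d i powr t) = V ** diag_matrix (\<lambda>i. e i powr t) ** conj_transpose V"
    unfolding conj_diag_def using U d by blast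
next
  fix Y
  assume "\<exists>(V :: 'a^'n^'n) e. V ** conj_transpose V = mat 1 \<and> (\<forall>i. 0 < e i) \<and>
     conj_diag U d = V ** diag_matrix e ** conj_transpose V \<and>
     Y = V ** diag_matrix (\<lambda>i. e i powr t) ** conj_transpose V"
  then obtain V :: "'a^'n^'n" and e where V: "V ** conj_transpose V = mat 1" and eq: "conj_diag U d = conj_diag V e"
    and Y: "Y = conj_diag V (\<lambda>i. e i powr t)"
    unfolding conj_diag_def by blast
  have "mat 1 ** conj_diag U (\<lambda>i. d i powr t) = conj_diag V (\<lambda>i. e i powr t) ** mat 1"
    by (rule intertwining_conj_diag[OF U V]) (simp add: eq)
  then show "Y = conj_diag U (\<lambda>i. d i powr t)"
    by (simp add: Y)
qed

context
  fixes X :: "'a::star_division^'n^'n"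
  assumes X: "X \<in> pos_def_matrices"
begin

lemma pos_def_matrix_powr: "matrix_powr X t \<in> pos_def_matrices"
proof -
  obtain U d where *: "U ** conj_transpose U = mat 1" "\<And>i. d i > 0" "X = conj_diag U d"
    using pos_def_diagonalisation[OF X] by metis
  show ?thesis
    unfolding *(3) matrix_powr_conj_diag[OF *(1,2)] using *(1,2)
    by (intro pos_def_conj_diag) (simp_all add: less_le)
qed

lemma matrix_powr_add: "matrix_powr X s ** matrix_powr X t = matrix_powr X (s + t)"
proof -
  obtain U d where *: "U ** conj_transpose U = mat 1" "\<And>i. d i > 0" "X = conj_diag U d"
    using pos_def_diagonalisation[OF X] by metis
  show ?thesis
    unfolding *(3) matrix_powr_conj_diag[OF *(1,2)] conj_diag_mult[OF *(1)]
    by (simp add: powr_add)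
qed

lemma matrix_powr_powr: "matrix_powr (matrix_powr X s) t = matrix_powr X (s * t)"
proof -
  obtain U d where *: "U ** conj_transpose U = mat 1" "\<And>i. d i > 0" "X = conj_diag U d"
    using pos_def_diagonalisation[OF X] by metis
  have "d i powr s > 0" for i
    using *(2)[of i] by simp
  then have "matrix_powr (matrix_powr X s) t = conj_diag U (\<lambda>i. (d i powr s) powr t)"
    unfolding *(3) matrix_powr_conj_diag[OF *(1,2)] by (rule matrix_powr_conj_diag[OF *(1)])
  then show ?thesis
    by (simp add: *(3) matrix_powr_conj_diag[OF *(1,2)] powr_powr)
qed

lemma matrix_powr_0: "matrix_powr X 0 = mat 1"
  and matrix_powr_1: "matrix_powr X 1 = X"
proof -
  obtain U d where *: "U ** conj_transpose U = mat 1" "\<And>i. d i > 0" "X = conj_diag U d"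
    using pos_def_diagonalisation[OF X] by metis
  have "d i \<noteq> 0" "\<bar>d i\<bar> = d i" for i
    using *(2)[of i] by simp_all
  then show "matrix_powr X 0 = mat 1" "matrix_powr X 1 = X"
    unfolding *(3) matrix_powr_conj_diag[OF *(1,2)] using conj_diag_1[OF *(1)] by simp_all
qed

lemma matrix_powr_commute:
  assumes "Z ** X = X ** Z"
  shows "Z ** matrix_powr X t = matrix_powr X t ** Z"
proof -
  obtain U d where *: "U ** conj_transpose U = mat 1" "\<And>i. d i > 0" "X = conj_diag U d"
    using pos_def_diagonalisation[OF X] by metis
  show ?thesis
    unfolding *(3) matrix_powr_conj_diag[OF *(1,2)]
    by (rule intertwining_conj_diag[OF *(1) *(1)]) (use assms *(3) in simp)
qed

lemma matrix_inv_eq_matrix_powr: "matrix_inv X = matrix_powr X (- 1)"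
proof -
  have 1: "X ** matrix_powr X (- 1) = mat 1" "matrix_powr X (- 1) ** X = mat 1"
    using matrix_powr_add[of 1 "- 1"] matrix_powr_add[of "- 1" 1]
    by (simp_all add: matrix_powr_0 matrix_powr_1)
  then have "X ** matrix_inv X = mat 1 \<and> matrix_inv X ** X = mat 1"
    unfolding matrix_inv_def by (metis (mono_tags, lifting) someI_ex)
  then show ?thesis
    by (metis 1 matrix_mul_assoc matrix_mul_lid matrix_mul_rid)
qed

end

lemma pos_def_congruence:
  fixes X :: "'a::star_division^'n^'n"
  assumes X: "X \<in> pos_def_matrices" and C: "D ** C = mat 1"
  shows "conj_transpose C ** X ** C \<in> pos_def_matrices"
proof -
  have Xc: "conj_transpose X = X" and Xp: "\<And>v. v \<noteq> 0 \<Longrightarrow> v \<bullet> (X *v v) > 0"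
    using X by (auto simp: pos_def_matrices_iff)
  have "v \<bullet> ((conj_transpose C ** X ** C) *v v) > 0" if v: "v \<noteq> 0" for v
  proof -
    have "C *v v \<noteq> 0"
      using v by (metis C matrix_vector_mul_assoc matrix_vector_mul_lid matrix_vector_mult_0_right)
    then have "(C *v v) \<bullet> (X *v (C *v v)) > 0"
      by (rule Xp)
    then show ?thesis
      by (simp add: inner_matrix_vector matrix_vector_mul_assoc matrix_mul_assoc)
  qed
  then show ?thesis
    by (simp add: pos_def_matrices_iff conj_transpose_mult Xc matrix_mul_assoc)
qed

text \<open>In eigencoordinates a right eigenvector \<open>w\<close> for \<open>l\<close> has a non-zero entry with
  \<open>d k * w $ k = w $ k * l\<close>. The real number \<open>d k\<close> moves past \<open>w $ k\<close>, so that \<open>l = d k\<close>: in the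
  quaternionic case, too, no further conjugates appear and the spectrum is finite.\<close>

lemma spec_conj_diag:
  fixes U :: "'a::star_division^'n^'n"
  assumes U: "U ** conj_transpose U = mat 1"
  shows "spec (conj_diag U d) = of_real ` range d"
proof (intro set_eqI iffI)
  fix l :: 'a
  assume "l \<in> spec (conj_diag U d)"
  then obtain v where v: "v \<noteq> 0" "conj_diag U d *v v = (\<chi> i. v $ i * l)"
    by (auto simp: spec_def)
  define w where "w = conj_transpose U *v v"
  have "U *v w = v"
    by (simp add: w_def matrix_vector_mul_assoc U)
  with v(1) have "w \<noteq> 0"
    by auto
  then obtain k where k: "w $ k \<noteq> 0"
    by (auto simp: vec_eq_iff)
  have "diag_matrix d *v w = conj_transpose U *v (conj_diag U d *v v)"
    by (simp add: w_def conj_diag_def matrix_vector_mul_assoc matrix_mul_assoc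
      unitary_left_inverse[OF U])
  also have "\<dots> = (\<chi> i. w $ i * l)"
    unfolding v(2) by (simp add: w_def matrix_vector_mult_def vec_eq_iff sum_distrib_right mult.assoc)
  finally have "(diag_matrix d *v w) $ k = w $ k * l"
    by simp
  then have "w $ k * of_real (d k) = w $ k * l"
    by (simp add: matrix_vector_mult_def diag_matrix_def if_distrib if_distribR of_real_def
      cong: if_cong)
  then show "l \<in> of_real ` range d"
    using k by auto
next
  fix l :: 'a
  assume "l \<in> of_real ` range d"
  then obtain k where l: "l = of_real (d k)"
    by auto
  have "diag_matrix d *v axis k 1 = d k *\<^sub>R (axis k 1 :: 'a^'n)"
    by (auto simp: vec_eq_iff matrix_vector_axis diag_matrix_def axis_nth_if of_real_def)
  then have "U *v (diag_matrix d *v axis k 1) = d k *\<^sub>R (U *v axis k 1)"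
    by (simp add: linear_cmul[OF matrix_vector_mul_linear])
  then have "conj_diag U d *v (U *v axis k 1) = d k *\<^sub>R (U *v axis k 1)"
    by (simp add: conj_diag_def matrix_vector_mul_assoc matrix_mul_assoc[symmetric]
      unitary_left_inverse[OF U])
  also have "\<dots> = (\<chi> i. (U *v axis k 1) $ i * l)"
    by (simp add: vec_eq_iff l of_real_def)
  finally have "conj_diag U d *v (U *v axis k 1) = (\<chi> i. (U *v axis k 1) $ i * l)" .
  moreover have "U *v axis k 1 \<noteq> 0"
  proof
    assume "U *v axis k 1 = 0"
    then have "axis k 1 = (0::'a^'n)"
      by (metis unitary_left_inverse[OF U] matrix_vector_mul_assoc matrix_vector_mul_lid
        matrix_vector_mult_0_right)
    then show False
      by (simp add: axis_eq_0_iff)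
  qed
  ultimately show "l \<in> spec (conj_diag U d)"
    by (auto simp: spec_def)
qed


section \<open>Linearizability\<close>

lemma conj_diag_linear:
  fixes U :: "'a::conj_real_div_algebra^'n^'n"
  shows "conj_diag U (\<lambda>i. a * d i + b * e i) = a *\<^sub>R conj_diag U d + b *\<^sub>R conj_diag U e"
proof -
  have "diag_matrix (\<lambda>i. a * d i + b * e i) = a *\<^sub>R diag_matrix d + b *\<^sub>R (diag_matrix e :: 'a^'n^'n)"
    by (simp add: diag_matrix_def vec_eq_iff of_real_def scaleR_left_distrib)
  then show ?thesis
    by (simp add: conj_diag_def matrix_add_ldistrib matrix_add_rdistrib matrix_scalar_ac
      scalar_matrix_assoc)
qed

text \<open>The mean \<open>G\<close> of \<open>A\<^sup>-\<^sup>1\<close> and \<open>B\<close> solves the Riccati equation \<open>G A G = B\<close>. It is built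
  from \<open>A\<close> and \<open>B\<close> by products and powers, so that \<open>A\<close> commutes with it whenever \<open>A\<close> commutes with
  \<open>B\<close>.\<close>

lemma geometric_mean_inv:
  fixes A B :: "'a::star_division^'n^'n"
  assumes A: "A \<in> pos_def_matrices" and B: "B \<in> pos_def_matrices"
  defines "G \<equiv> geometric_mean (matrix_inv A) B"
  shows geometric_mean_inv_pos_def: "G \<in> pos_def_matrices"
    and geometric_mean_inv_riccati: "G ** A ** G = B"
    and geometric_mean_inv_commute: "A ** B = B ** A \<Longrightarrow> A ** G = G ** A"
proof -
  define P where "P = matrix_powr A (- 1 / 2)"
  define Q where "Q = matrix_powr A (1 / 2)"
  define R where "R = matrix_powr (Q ** B ** Q) (1 / 2)"
  have G: "G = P ** R ** P"
    by (simp add: G_def geometric_mean_def matrix_inv_eq_matrix_powr[OF A] matrix_powr_powr[OF A]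
      P_def Q_def R_def)
  have PQ: "P ** Q = mat 1" "Q ** P = mat 1" and QQ: "Q ** Q = A"
    by (simp_all add: P_def Q_def matrix_powr_add[OF A] matrix_powr_0[OF A] matrix_powr_1[OF A])
  have P: "conj_transpose P = P" and Q: "conj_transpose Q = Q"
    using pos_def_matrix_powr[OF A] by (simp_all add: P_def Q_def pos_def_matrices_iff)
  have QBQ: "Q ** B ** Q \<in> pos_def_matrices"
    using pos_def_congruence[OF B PQ(1)] by (simp add: Q)
  have "R \<in> pos_def_matrices"
    unfolding R_def by (rule pos_def_matrix_powr[OF QBQ])
  then show "G \<in> pos_def_matrices"
    unfolding G using pos_def_congruence[OF _ PQ(2)] by (simp add: P)
  have RR: "R ** R = Q ** B ** Q"
    by (simp add: R_def matrix_powr_add[OF QBQ] matrix_powr_1[OF QBQ])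
  have "G ** A ** G = P ** R ** (P ** Q) ** (Q ** P) ** R ** P"
    by (simp only: G QQ[symmetric] matrix_mul_assoc)
  also have "\<dots> = P ** (R ** R) ** P"
    by (simp add: PQ matrix_mul_assoc)
  also have "\<dots> = (P ** Q) ** B ** (Q ** P)"
    by (simp only: RR matrix_mul_assoc)
  finally show "G ** A ** G = B"
    by (simp add: PQ)
  assume AB: "A ** B = B ** A"
  have AP: "A ** P = P ** A" and AQ: "A ** Q = Q ** A"
    unfolding P_def Q_def by (simp_all add: matrix_powr_commute[OF A])
  have "A ** (Q ** B ** Q) = (Q ** B ** Q) ** A"
    by (metis AB AQ matrix_mul_assoc)
  then have "A ** R = R ** A"
    unfolding R_def by (rule matrix_powr_commute[OF QBQ])
  then show "A ** G = G ** A"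
    unfolding G by (metis AP matrix_mul_assoc)
qed

text \<open>In eigencoordinates of \<open>G\<close>, with \<open>C = U\<^sup>* A U\<close>, the relation reads
  \<open>(g\<^sub>i + g\<^sub>j) C\<^sub>i\<^sub>j = (\<alpha> + \<beta> g\<^sub>i g\<^sub>j) C\<^sub>i\<^sub>j\<close>. The diagonal entries of \<open>C\<close> are positive, so every
  \<open>g\<^sub>i\<close> is a root of \<open>\<beta> x\<^sup>2 - 2 x + \<alpha>\<close>, which has at most two roots. If
  \<open>C\<^sub>i\<^sub>j\<close> does not vanish, subtracting twice its equation from the sum of the diagonal equations for
  \<open>i\<close> and \<open>j\<close> leaves \<open>\<beta> (g\<^sub>i - g\<^sub>j)\<^sup>2 = 0\<close>. So \<open>g\<^sub>i = g\<^sub>j\<close>, also for \<open>\<beta> = 0\<close>, where all \<open>g\<^sub>i\<close> equal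
  \<open>\<alpha> / 2\<close>. Hence \<open>C\<close> commutes with the diagonal matrix.\<close>

lemma anticommutator_relation_imp:
  fixes A U :: "'a::star_division^'n^'n" and g :: "'n \<Rightarrow> real"
  assumes A: "A \<in> pos_def_matrices" and U: "U ** conj_transpose U = mat 1"
  defines "G \<equiv> conj_diag U g"
  assumes eq: "G ** A + A ** G = \<alpha> *\<^sub>R A + \<beta> *\<^sub>R (G ** A ** G)"
  shows "G ** A = A ** G" and "card (range g) \<le> 2"
proof -
  note U' = unitary_left_inverse[OF U]
  define C where "C = conj_transpose U ** A ** U"
  have C: "C \<in> pos_def_matrices"
    unfolding C_def by (rule pos_def_congruence[OF A U'])
  have A_eq: "A = U ** C ** conj_transpose U"
    by (metis C_def U matrix_mul_assoc matrix_mul_lid matrix_mul_rid)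
  let ?D = "diag_matrix g"
  have 1: "conj_transpose U ** (G ** A) ** U = ?D ** C"
    and 2: "conj_transpose U ** (A ** G) ** U = C ** ?D"
    by (simp_all add: C_def G_def conj_diag_def matrix_mul_assoc U')
       (simp_all add: matrix_mul_assoc[symmetric] U')
  have 3: "conj_transpose U ** (G ** A ** G) ** U = ?D ** C ** ?D"
    by (simp add: C_def G_def conj_diag_def matrix_mul_assoc U')
       (simp add: matrix_mul_assoc[symmetric] U')
  have "conj_transpose U ** (G ** A + A ** G) ** U = ?D ** C + C ** ?D"
    by (simp only: matrix_add_ldistrib matrix_add_rdistrib 1 2)
  moreover have "conj_transpose U ** (\<alpha> *\<^sub>R A + \<beta> *\<^sub>R (G ** A ** G)) ** U
      = \<alpha> *\<^sub>R C + \<beta> *\<^sub>R (?D ** C ** ?D)"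
    by (simp add: matrix_add_ldistrib matrix_add_rdistrib matrix_scalar_ac
      scalar_matrix_assoc[symmetric] 3 C_def[symmetric])
  ultimately have "?D ** C + C ** ?D = \<alpha> *\<^sub>R C + \<beta> *\<^sub>R (?D ** C ** ?D)"
    using eq by simp
  then have "(?D ** C + C ** ?D) $ i $ j = (\<alpha> *\<^sub>R C + \<beta> *\<^sub>R (?D ** C ** ?D)) $ i $ j" for i j
    by simp
  then have "(g i + g j) *\<^sub>R C $ i $ j = (\<alpha> + \<beta> * (g i * g j)) *\<^sub>R C $ i $ j" for i j
    by (simp add: matrix_mult_diag_nth diag_mult_matrix_nth scaleR_left_distrib mult_ac)
  then have entry: "C $ i $ j \<noteq> 0 \<Longrightarrow> g i + g j = \<alpha> + \<beta> * (g i * g j)" for i j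
    by (metis scaleR_right_imp_eq)
  have "C $ i $ i \<noteq> 0" for i
  proof
    assume "C $ i $ i = 0"
    then have "axis i 1 \<bullet> (C *v axis i 1) = 0"
      by (simp add: inner_commute[of "axis i 1"] inner_axis matrix_vector_axis)
    moreover have "axis i 1 \<noteq> (0::'a^'n)"
      by (simp add: axis_eq_0_iff)
    ultimately show False
      using C unfolding pos_def_matrices_iff by (metis less_irrefl)
  qed
  then have quad: "2 * g i = \<alpha> + \<beta> * (g i * g i)" for i
    using entry[of i i] by simp
  have "g i = g j" if "C $ i $ j \<noteq> 0" for i j
  proof -
    have "\<beta> * ((g i - g j) * (g i - g j))
        = \<beta> * (g i * g i) + \<beta> * (g j * g j) - 2 * (\<beta> * (g i * g j))"
      by (simp add: algebra_simps)
    also have "\<dots> = 0"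
      using entry[OF that] quad[of i] quad[of j] by linarith
    finally show ?thesis
      using quad[of i] quad[of j] by auto
  qed
  then have "?D ** C = C ** ?D"
    by (auto simp: vec_eq_iff matrix_mult_diag_nth diag_mult_matrix_nth)
  then have "U ** (?D ** C) ** conj_transpose U = U ** (C ** ?D) ** conj_transpose U"
    by simp
  then show "G ** A = A ** G"
    by (simp add: A_eq G_def conj_diag_def matrix_mul_assoc)
       (simp add: matrix_mul_assoc[symmetric] U')
  \<comment> \<open>An arbitrary index serves as a base point: any other root of the quadratic is the second root,
    known from the sum \<open>2 / \<beta>\<close> of the roots. The case \<open>\<beta> = 0\<close> leaves only one root.\<close>
  have "g i = g undefined \<or> g i = 2 / \<beta> - g undefined" for i
  proof -
    have "(g i - g undefined) * (2 - \<beta> * (g i + g undefined)) = 0"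
      using quad[of i] quad[of undefined] by (simp add: algebra_simps)
    then have "g i = g undefined \<or> \<beta> * (g i + g undefined) = 2"
      by auto
    moreover have "g i + g undefined = 2 / \<beta>" if "\<beta> * (g i + g undefined) = 2"
      using that by (auto simp: eq_divide_eq mult.commute)
    ultimately show ?thesis
      by (metis add_diff_cancel_right')
  qed
  then have "range g \<subseteq> {g undefined, 2 / \<beta> - g undefined}"
    by blast
  then have "card (range g) \<le> card {g undefined, 2 / \<beta> - g undefined}"
    by (intro card_mono) auto
  also have "\<dots> \<le> 2"
    by (simp add: card_insert_if)
  finally show "card (range g) \<le> 2" .
qed

text \<open>If \<open>x\<close> and \<open>y\<close> are the eigenvalues of \<open>G\<close>, possibly equal, then \<open>G\<^sup>2 - (x + y) G + x y = 0\<close>. Positivity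
  allows division by \<open>x + y\<close>, which expresses \<open>2 G\<close> by the identity and \<open>G\<^sup>2\<close>; multiplying by
  \<open>A\<close>, which commutes with \<open>G\<close>, gives the relation.\<close>

lemma anticommutator_relation_exists:
  fixes A U :: "'a::star_division^'n^'n" and g :: "'n \<Rightarrow> real"
  assumes U: "U ** conj_transpose U = mat 1" and g: "\<And>i. g i > 0"
  defines "G \<equiv> conj_diag U g"
  assumes comm: "G ** A = A ** G" and card: "card (range g) \<le> 2"
  obtains \<alpha> \<beta> where "G ** A + A ** G = \<alpha> *\<^sub>R A + \<beta> *\<^sub>R (G ** A ** G)"
proof -
  have "card (range g) = 1 \<or> card (range g) = 2"
    using card by (simp add: le_Suc_eq numeral_2_eq_2)
  then obtain x y where xy: "range g = {x, y}"
    by (metis card_1_singletonE card_2_iff insert_absorb2)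
  then have "x > 0" "y > 0"
    using g by (metis insertI1 insertI2 rangeE)+
  then have s: "x + y \<noteq> 0" by simp
  define \<alpha> where "\<alpha> = 2 * x * y / (x + y)"
  define \<beta> where "\<beta> = 2 / (x + y)"
  have "2 * g i + 0 * 1 = \<alpha> * 1 + \<beta> * (g i * g i)" for i
  proof -
    have "g i \<in> {x, y}"
      using xy by blast
    then have "2 * g i * (x + y) = 2 * x * y + 2 * (g i * g i)"
      by (auto simp: algebra_simps)
    then have "2 * g i = (2 * x * y + 2 * (g i * g i)) / (x + y)"
      using s by (simp add: nonzero_eq_divide_eq)
    then show ?thesis
      by (simp add: \<alpha>_def \<beta>_def add_divide_distrib)
  qed
  then have "conj_diag U (\<lambda>i. 2 * g i + 0 * 1) = conj_diag U (\<lambda>i. \<alpha> * 1 + \<beta> * (g i * g i))"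
    by simp
  then have "2 *\<^sub>R G = \<alpha> *\<^sub>R mat 1 + \<beta> *\<^sub>R (G ** G)"
    unfolding conj_diag_linear by (simp add: conj_diag_1[OF U] conj_diag_mult[OF U] G_def)
  then have "(2 *\<^sub>R G) ** A = (\<alpha> *\<^sub>R mat 1 + \<beta> *\<^sub>R (G ** G)) ** A"
    by simp
  then have "G ** A + A ** G = \<alpha> *\<^sub>R A + \<beta> *\<^sub>R (G ** A ** G)"
    by (simp add: comm[symmetric] matrix_add_rdistrib scalar_matrix_assoc[symmetric] scaleR_2
      matrix_mul_assoc[symmetric])
  then show thesis
    by (rule that)
qed

text \<open>Expanding the Wasserstein mean with \<open>G A G = B\<close> gives
  \<open>4 (A \<diamond> B) = A + B + (G A + A G)\<close>, so linearizability means that the anticommutator of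
  \<open>G\<close> and \<open>A\<close> is a real combination of \<open>A\<close> and \<open>G A G\<close>. The Riccati
  equation also shows that \<open>A\<close> commutes with \<open>B\<close> once it commutes with \<open>G\<close>; the converse is
  \<open>geometric_mean_inv_commute\<close>.\<close>

theorem linearizable_wasserstein_iff:
  fixes A B :: "'a::star_division^'n^'n"
  assumes A: "A \<in> pos_def_matrices" and B: "B \<in> pos_def_matrices"
  shows "linearizable_wasserstein A B \<longleftrightarrow>
    A ** B = B ** A \<and>
    finite (spec (geometric_mean (matrix_inv A) B)) \<and>
    card (spec (geometric_mean (matrix_inv A) B)) \<le> 2"
proof -
  define G where "G = geometric_mean (matrix_inv A) B"
  have G: "G \<in> pos_def_matrices" and GAG: "G ** A ** G = B"
    and comm: "A ** B = B ** A \<Longrightarrow> A ** G = G ** A"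
    using geometric_mean_inv[OF A B] by (simp_all add: G_def)
  obtain U g where U: "U ** conj_transpose U = mat 1" and g: "\<And>i. g i > 0" and G_eq: "G = conj_diag U g"
    using pos_def_diagonalisation[OF G] by metis
  have spec: "spec G = of_real ` range g"
    unfolding G_eq by (rule spec_conj_diag[OF U])
  have card_spec: "finite (spec G)" "card (spec G) = card (range g)"
    unfolding spec by (simp_all add: card_image inj_on_def)
  have W: "4 *\<^sub>R wasserstein_mean A B = A + B + (G ** A + A ** G)"
    by (simp add: wasserstein_mean_def G_def[symmetric] matrix_add_ldistrib matrix_add_rdistrib GAG)
  have lin: "linearizable_wasserstein A B \<longleftrightarrow> (\<exists>\<alpha> \<beta>. G ** A + A ** G = \<alpha> *\<^sub>R A + \<beta> *\<^sub>R B)"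
  proof
    assume "linearizable_wasserstein A B"
    then obtain a b where "wasserstein_mean A B = a *\<^sub>R A + b *\<^sub>R B"
      by (auto simp: linearizable_wasserstein_def)
    then have "G ** A + A ** G = (4 * a - 1) *\<^sub>R A + (4 * b - 1) *\<^sub>R B"
      using W by (simp add: algebra_simps)
    then show "\<exists>\<alpha> \<beta>. G ** A + A ** G = \<alpha> *\<^sub>R A + \<beta> *\<^sub>R B"
      by blast
  next
    assume "\<exists>\<alpha> \<beta>. G ** A + A ** G = \<alpha> *\<^sub>R A + \<beta> *\<^sub>R B"
    then obtain \<alpha> \<beta> where "4 *\<^sub>R wasserstein_mean A B = (1 + \<alpha>) *\<^sub>R A + (1 + \<beta>) *\<^sub>R B"
      using W by (auto simp: algebra_simps)
    then have "(1/4) *\<^sub>R (4 *\<^sub>R wasserstein_mean A B) = (1/4) *\<^sub>R ((1 + \<alpha>) *\<^sub>R A + (1 + \<beta>) *\<^sub>R B)"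
      by simp
    then have "wasserstein_mean A B = ((1 + \<alpha>) / 4) *\<^sub>R A + ((1 + \<beta>) / 4) *\<^sub>R B"
      by (simp add: scaleR_right_distrib)
    then show "linearizable_wasserstein A B"
      unfolding linearizable_wasserstein_def by blast
  qed
  show ?thesis
    unfolding G_def[symmetric] card_spec lin
  proof safe
    fix \<alpha> \<beta>
    assume "G ** A + A ** G = \<alpha> *\<^sub>R A + \<beta> *\<^sub>R B"
    then have "G ** A + A ** G = \<alpha> *\<^sub>R A + \<beta> *\<^sub>R (G ** A ** G)"
      by (simp only: GAG)
    note this[unfolded G_eq]
    note * = anticommutator_relation_imp[OF A U this]
    have "G ** A = A ** G"
      using *(1) G_eq by simp
    then show "A ** B = B ** A"
      by (metis GAG matrix_mul_assoc)
    show "card (range g) \<le> 2"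
      by (rule *(2))
    show "finite (spec G)"
      by (rule card_spec)
  next
    assume AB: "A ** B = B ** A" and card: "card (range g) \<le> 2"
    have "conj_diag U g ** A = A ** conj_diag U g"
      using comm[OF AB] G_eq by simp
    then obtain \<alpha> \<beta> where "G ** A + A ** G = \<alpha> *\<^sub>R A + \<beta> *\<^sub>R (G ** A ** G)"
      using anticommutator_relation_exists[OF U g _ card] G_eq by metis
    then show "\<exists>\<alpha> \<beta>. G ** A + A ** G = \<alpha> *\<^sub>R A + \<beta> *\<^sub>R B"
      unfolding GAG by blast
  qed
qed


section \<open>Real, complex and quaternionic matrices\<close>

theorem theorem3p2:
  shows
    "(\<forall>A \<in> pos_def_matrices. \<forall>B \<in> pos_def_matrices.
        linearizable_wasserstein (A :: real^'n^'n) B \<longleftrightarrow>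
          A ** B = B ** A \<and>
          finite (spec (geometric_mean (matrix_inv A) B)) \<and>
          card (spec (geometric_mean (matrix_inv A) B)) \<le> 2) \<and>
     (\<forall>A \<in> pos_def_matrices. \<forall>B \<in> pos_def_matrices.
        linearizable_wasserstein (A :: complex^'n^'n) B \<longleftrightarrow>
          A ** B = B ** A \<and>
          finite (spec (geometric_mean (matrix_inv A) B)) \<and>
          card (spec (geometric_mean (matrix_inv A) B)) \<le> 2) \<and>
     (\<forall>A \<in> pos_def_matrices. \<forall>B \<in> pos_def_matrices.
        linearizable_wasserstein (A :: quat^'n^'n) B \<longleftrightarrow>
          A ** B = B ** A \<and>
          finite (spec (geometric_mean (matrix_inv A) B)) \<and>
          card (spec (geometric_mean (matrix_inv A) B)) \<le> 2)"
  by (intro conjI ballI linearizable_wasserstein_iff)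

end
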